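(* If $\mathcal P$ is a finite classical polar space of rank $n\ge 3$, then its collinearity graph is not triply transitive.
   Context: A finite classical polar space is given by a finite-dimensional vector space $V$ over $\mathbb F_q$ with a non-degenerate alternating, Hermitian or quadratic form; its points are the totally isotropic (respectively totally singular) $1$-dimensional subspaces, and its rank is the maximal dimension of a totally isotropic (totally singular) subspace. The collinearity graph has these points as vertices, two distinct points being adjacent iff the $2$-space they span is totally isotropic (totally singular). For a strongly regular graph $\Gamma=(W,E)$: $A_0=I$, $A_1$ its adjacency matrix, $A_2=J-I-A_1$; for a vertex $\omega$, $E^*_{i,\omega}$ ($i=0,1,2$) is the diagonal matrix whose diagonal is the $\omega$-row of $A_i$; $T_\omega$ is the algebra generated by $A_0,A_1,A_2,E^*_{0,\omega},E^*_{1,\omega},E^*_{2,\omega}$; $T_{0,\omega}$ is the span of all $E^*_{i,\omega}A_jE^*_{k,\omega}$; $\tilde T_\omega$ is the algebra of complex matrices commuting with the permutation matrices of the stabilizer $G_\omega$ in $G=\mathrm{Aut}(\Gamma)$. $\Gamma$ is triply transitive if $G$ is transitive and $T_{0,\omega}=T_\omega=\tilde T_\omega$ for some (equivalently every) vertex $\omega$. *)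

theory Defs
  imports
    Complex_Main
    "HOL-Library.Function_Algebras"
    "HOL-Combinatorics.Permutations"
    "Graph_Theory.Pair_Digraph"
begin

section \<open>Classical polar spaces\<close>

text \<open>A Hermitian form carries the involution \<open>\<sigma>\<close> of the ground field with respect to which it is
  sesquilinear.\<close>

datatype ('k, 'v) form =
    Alternating "'v \<Rightarrow> 'v \<Rightarrow> 'k"
  | Hermitian "'k \<Rightarrow> 'k" "'v \<Rightarrow> 'v \<Rightarrow> 'k"
  | Quadratic "'v \<Rightarrow> 'k"

definition field_involution :: "('k::field \<Rightarrow> 'k) \<Rightarrow> bool" where
  "field_involution \<sigma> \<longleftrightarrow>
     (\<forall>a b. \<sigma> (a + b) = \<sigma> a + \<sigma> b) \<and> (\<forall>a b. \<sigma> (a * b) = \<sigma> a * \<sigma> b) \<and>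
     (\<forall>a. \<sigma> (\<sigma> a) = a) \<and> \<sigma> \<noteq> id"

definition polar_form ::
    "('v::ab_group_add \<Rightarrow> 'k::field) \<Rightarrow> 'v \<Rightarrow> 'v \<Rightarrow> 'k" where
  "polar_form Q x y = Q (x + y) - Q x - Q y"

definition bilinear_form ::
    "('k::field \<Rightarrow> 'v::ab_group_add \<Rightarrow> 'v) \<Rightarrow> ('v \<Rightarrow> 'v \<Rightarrow> 'k) \<Rightarrow> bool" where
  "bilinear_form scale B \<longleftrightarrow>
     (\<forall>x. Vector_Spaces.linear scale (*) (\<lambda>y. B x y)) \<and>
     (\<forall>y. Vector_Spaces.linear scale (*) (\<lambda>x. B x y))"

definition alternating_form ::
    "('k::field \<Rightarrow> 'v::ab_group_add \<Rightarrow> 'v) \<Rightarrow> ('v \<Rightarrow> 'v \<Rightarrow> 'k) \<Rightarrow> bool" where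
  "alternating_form scale B \<longleftrightarrow> bilinear_form scale B \<and> (\<forall>x. B x x = 0)"

definition hermitian_form ::
    "('k::field \<Rightarrow> 'v::ab_group_add \<Rightarrow> 'v) \<Rightarrow> ('k \<Rightarrow> 'k) \<Rightarrow> ('v \<Rightarrow> 'v \<Rightarrow> 'k) \<Rightarrow> bool" where
  "hermitian_form scale \<sigma> H \<longleftrightarrow> field_involution \<sigma> \<and>
     (\<forall>y. Vector_Spaces.linear scale (*) (\<lambda>x. H x y)) \<and> (\<forall>x y. H y x = \<sigma> (H x y))"

definition quadratic_form ::
    "('k::field \<Rightarrow> 'v::ab_group_add \<Rightarrow> 'v) \<Rightarrow> ('v \<Rightarrow> 'k) \<Rightarrow> bool" where
  "quadratic_form scale Q \<longleftrightarrow> (\<forall>c x. Q (scale c x) = c\<^sup>2 * Q x) \<and> bilinear_form scale (polar_form Q)"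

text \<open>A quadratic form is non-degenerate if the radical of its polar form contains no nonzero
  singular vector. In odd characteristic this says that the polar form is non-degenerate; in
  characteristic 2 it also admits the parabolic quadrics in odd dimension, whose polar form has a
  one-dimensional radical.\<close>

fun nondegenerate_form ::
    "('k::field \<Rightarrow> 'v::ab_group_add \<Rightarrow> 'v) \<Rightarrow> ('k, 'v) form \<Rightarrow> bool" where
  "nondegenerate_form scale (Alternating B) \<longleftrightarrow>
     alternating_form scale B \<and> (\<forall>x. (\<forall>y. B x y = 0) \<longrightarrow> x = 0)"
| "nondegenerate_form scale (Hermitian \<sigma> H) \<longleftrightarrow>
     hermitian_form scale \<sigma> H \<and> (\<forall>x. (\<forall>y. H x y = 0) \<longrightarrow> x = 0)"
| "nondegenerate_form scale (Quadratic Q) \<longleftrightarrow>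
     quadratic_form scale Q \<and> (\<forall>x. Q x = 0 \<and> (\<forall>y. polar_form Q x y = 0) \<longrightarrow> x = 0)"

text \<open>Totally isotropic for alternating and Hermitian forms, totally singular for quadratic
  forms.\<close>

fun totally_isotropic ::
    "('k::field \<Rightarrow> 'v::ab_group_add \<Rightarrow> 'v) \<Rightarrow> ('k, 'v) form \<Rightarrow> 'v set \<Rightarrow> bool" where
  "totally_isotropic scale (Alternating B) U \<longleftrightarrow> module.subspace scale U \<and> (\<forall>x\<in>U. \<forall>y\<in>U. B x y = 0)"
| "totally_isotropic scale (Hermitian \<sigma> H) U \<longleftrightarrow> module.subspace scale U \<and> (\<forall>x\<in>U. \<forall>y\<in>U. H x y = 0)"
| "totally_isotropic scale (Quadratic Q) U \<longleftrightarrow> module.subspace scale U \<and> (\<forall>x\<in>U. Q x = 0)"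

definition polar_points ::
    "('k::field \<Rightarrow> 'v::ab_group_add \<Rightarrow> 'v) \<Rightarrow> ('k, 'v) form \<Rightarrow> 'v set set" where
  "polar_points scale \<phi> = {P. totally_isotropic scale \<phi> P \<and> vector_space.dim scale P = 1}"

definition polar_rank ::
    "('k::field \<Rightarrow> 'v::ab_group_add \<Rightarrow> 'v) \<Rightarrow> ('k, 'v) form \<Rightarrow> nat" where
  "polar_rank scale \<phi> = Max {vector_space.dim scale U | U. totally_isotropic scale \<phi> U}"

definition collinearity_graph ::
    "('k::field \<Rightarrow> 'v::ab_group_add \<Rightarrow> 'v) \<Rightarrow> ('k, 'v) form \<Rightarrow> 'v set pair_pre_digraph" where
  "collinearity_graph scale \<phi> =
     \<lparr> pverts = polar_points scale \<phi>,
       parcs = {(P, R). P \<in> polar_points scale \<phi> \<and> R \<in> polar_points scale \<phi> \<and> P \<noteq> R \<and>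
                        totally_isotropic scale \<phi> (module.span scale (P \<union> R))} \<rparr>"

locale classical_polar_space =
  finite_dimensional_vector_space scale Basis
  for scale :: "'k::{field,finite} \<Rightarrow> 'v::ab_group_add \<Rightarrow> 'v" and Basis :: "'v set" +
  fixes \<phi> :: "('k, 'v) form"
  assumes nondegenerate: "nondegenerate_form scale \<phi>"


section \<open>Complex matrices indexed by a finite set\<close>

text \<open>A matrix with rows and columns indexed by \<open>W\<close> is a function vanishing outside \<open>W \<times> W\<close>. Sums
  and differences of matrices are the pointwise ones on functions.\<close>

type_synonym 'v cmat = "'v \<Rightarrow> 'v \<Rightarrow> complex"

definition cmats :: "'v set \<Rightarrow> 'v cmat set" where
  "cmats W = {M. \<forall>x y. x \<notin> W \<or> y \<notin> W \<longrightarrow> M x y = 0}"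

definition mat_scale :: "complex \<Rightarrow> 'v cmat \<Rightarrow> 'v cmat" where
  "mat_scale c M = (\<lambda>x y. c * M x y)"

definition mat_mult :: "'v set \<Rightarrow> 'v cmat \<Rightarrow> 'v cmat \<Rightarrow> 'v cmat" where
  "mat_mult W M N = (\<lambda>x y. \<Sum>z\<in>W. M x z * N z y)"

definition mat_id :: "'v set \<Rightarrow> 'v cmat" where
  "mat_id W = (\<lambda>x y. of_bool (x \<in> W \<and> x = y))"

definition mat_J :: "'v set \<Rightarrow> 'v cmat" where
  "mat_J W = (\<lambda>x y. of_bool (x \<in> W \<and> y \<in> W))"

definition perm_mat :: "'v set \<Rightarrow> ('v \<Rightarrow> 'v) \<Rightarrow> 'v cmat" where
  "perm_mat W g = (\<lambda>x y. of_bool (x \<in> W \<and> y = g x))"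

definition mat_algebra :: "'v set \<Rightarrow> 'v cmat set \<Rightarrow> bool" where
  "mat_algebra W \<A> \<longleftrightarrow> \<A> \<subseteq> cmats W \<and> module.subspace mat_scale \<A> \<and>
     (\<forall>M\<in>\<A>. \<forall>N\<in>\<A>. mat_mult W M N \<in> \<A>)"


section \<open>Triply transitive graphs\<close>

definition automorphisms :: "'v pair_pre_digraph \<Rightarrow> ('v \<Rightarrow> 'v) set" where
  "automorphisms G = {g. g permutes pverts G \<and>
     (\<forall>x\<in>pverts G. \<forall>y\<in>pverts G. (g x, g y) \<in> parcs G \<longleftrightarrow> (x, y) \<in> parcs G)}"

definition vertex_transitive :: "'v pair_pre_digraph \<Rightarrow> bool" where
  "vertex_transitive G \<longleftrightarrow>
     (\<forall>x\<in>pverts G. \<forall>y\<in>pverts G. \<exists>g\<in>automorphisms G. g x = y)"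

definition adj_mat :: "'v pair_pre_digraph \<Rightarrow> 'v cmat" where
  "adj_mat G = (\<lambda>x y. of_bool (x \<in> pverts G \<and> y \<in> pverts G \<and> (x, y) \<in> parcs G))"

definition A_mat :: "'v pair_pre_digraph \<Rightarrow> nat \<Rightarrow> 'v cmat" where
  "A_mat G i = (if i = 0 then mat_id (pverts G)
                else if i = 1 then adj_mat G
                else mat_J (pverts G) - mat_id (pverts G) - adj_mat G)"

definition dual_mat :: "'v pair_pre_digraph \<Rightarrow> 'v \<Rightarrow> nat \<Rightarrow> 'v cmat" where
  "dual_mat G \<omega> i = (\<lambda>x y. if x = y then A_mat G i \<omega> x else 0)"

definition terwilliger_algebra :: "'v pair_pre_digraph \<Rightarrow> 'v \<Rightarrow> 'v cmat set" where
  "terwilliger_algebra G \<omega> =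
     mat_algebra (pverts G) hull (A_mat G ` {0, 1, 2} \<union> dual_mat G \<omega> ` {0, 1, 2})"

definition terwilliger_span :: "'v pair_pre_digraph \<Rightarrow> 'v \<Rightarrow> 'v cmat set" where
  "terwilliger_span G \<omega> = module.span mat_scale
     {mat_mult (pverts G) (mat_mult (pverts G) (dual_mat G \<omega> i) (A_mat G j)) (dual_mat G \<omega> k) | i j k.
        i \<in> {0, 1, 2} \<and> j \<in> {0, 1, 2} \<and> k \<in> {0, 1, 2}}"

definition stabilizer_centralizer :: "'v pair_pre_digraph \<Rightarrow> 'v \<Rightarrow> 'v cmat set" where
  "stabilizer_centralizer G \<omega> = {M \<in> cmats (pverts G). \<forall>g\<in>automorphisms G. g \<omega> = \<omega> \<longrightarrow>
     mat_mult (pverts G) M (perm_mat (pverts G) g) = mat_mult (pverts G) (perm_mat (pverts G) g) M}"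

text \<open>The notion is meant for strongly regular graphs, but the definition makes sense for every
  finite graph, and strong regularity is not built into it.\<close>

definition triply_transitive :: "'v pair_pre_digraph \<Rightarrow> bool" where
  "triply_transitive G \<longleftrightarrow> vertex_transitive G \<and>
     (\<exists>\<omega>\<in>pverts G. terwilliger_span G \<omega> = terwilliger_algebra G \<omega> \<and>
                  terwilliger_algebra G \<omega> = stabilizer_centralizer G \<omega>)"

end

theory Submission
  imports Defs
begin

text \<open>In a triply transitive graph the orbit of a pair \<open>(x, y)\<close> under \<open>G\<^sub>\<omega>\<close> depends only on the
  mutual relations of \<open>\<omega>, x, y\<close>. In a polar space of rank at least 3 a point \<open>\<omega>\<close> lies in a totally
  isotropic plane, so a triangle containing \<open>\<omega>\<close> may be a subset of a line or span a plane. The graph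
  tells the two apart: if \<open>\<omega>, x, y\<close> lie on a line then every common neighbour of \<open>\<omega>\<close> and \<open>x\<close> is
  equal or adjacent to \<open>y\<close>, while if they span a plane some common neighbour of \<open>\<omega>\<close> and \<open>x\<close> is not
  adjacent to \<open>y\<close>, by non-degeneracy.\<close>

section \<open>Triply transitive graphs\<close>

interpretation mat: module mat_scale
  by standard (auto simp: mat_scale_def fun_eq_iff algebra_simps)

section \<open>Matrix entries and relations of triples of vertices\<close>

lemma mat_mult_dual_left:
  assumes "finite (pverts G)" "x \<in> pverts G"
  shows "mat_mult (pverts G) (dual_mat G w i) M x y = A_mat G i w x * M x y"
  using assms by (simp add: mat_mult_def dual_mat_def if_distrib if_distribR cong: if_cong)

lemma mat_mult_dual_right:
  assumes "finite (pverts G)" "y \<in> pverts G"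
  shows "mat_mult (pverts G) M (dual_mat G w i) x y = M x y * A_mat G i w y"
  using assms by (simp add: mat_mult_def dual_mat_def if_distrib cong: if_cong)

lemma A_mat_cong_edge:
  assumes "(x, y) \<in> parcs G" "(x, y') \<in> parcs G" "x \<in> pverts G" "y \<in> pverts G" "y' \<in> pverts G"
    and "x \<noteq> y" "x \<noteq> y'"
  shows "A_mat G i x y = A_mat G i x y'"
  using assms by (simp add: A_mat_def mat_id_def mat_J_def adj_mat_def)

text \<open>The entry of a generator at \<open>(x, y)\<close> is
  \<open>A_mat G i w x * A_mat G j x y * A_mat G k w y\<close>, which depends only on the mutual
  relations of \<open>w\<close>, \<open>x\<close> and \<open>y\<close>. Equality of two fixed
  entries is a linear condition, so it passes from the generators to their span.\<close>

lemma terwilliger_span_const_on_triangles: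
  assumes "M \<in> terwilliger_span G w"
    and V: "finite (pverts G)" "w \<in> pverts G" "x \<in> pverts G" "y \<in> pverts G" "y' \<in> pverts G"
    and E: "(w, y) \<in> parcs G" "(w, y') \<in> parcs G" "(x, y) \<in> parcs G" "(x, y') \<in> parcs G"
    and loopfree: "\<And>v. (v, v) \<notin> parcs G"
  shows "M x y = M x y'"
proof -
  have ne: "w \<noteq> y" "w \<noteq> y'" "x \<noteq> y" "x \<noteq> y'"
    using E loopfree by auto
  have sub: "mat.subspace {M. M x y = M x y'}"
    by (auto simp: mat.subspace_def mat_scale_def)
  have gen: "mat_mult (pverts G) (mat_mult (pverts G) (dual_mat G w i) (A_mat G j)) (dual_mat G w k) x y =
      mat_mult (pverts G) (mat_mult (pverts G) (dual_mat G w i) (A_mat G j)) (dual_mat G w k) x y'"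
    for i j k
    using A_mat_cong_edge[OF E(1,2) V(2,4,5) ne(1,2)] A_mat_cong_edge[OF E(3,4) V(3-5) ne(3,4)] V
    by (simp add: mat_mult_dual_left mat_mult_dual_right)
  have "terwilliger_span G w \<subseteq> {M. M x y = M x y'}"
    unfolding terwilliger_span_def by (rule mat.span_minimal[OF _ sub]) (use gen in blast)
  with assms(1) show ?thesis by blast
qed

text \<open>Commuting with the permutation matrix of \<open>g\<close> says that the entries at
  \<open>(x, y)\<close> and \<open>(g x, g y)\<close> agree, so the 0/1 matrix of an invariant
  relation commutes with the whole stabilizer.\<close>

lemma invariant_in_stabilizer_centralizer:
  assumes fin: "finite (pverts G)"
    and inv: "\<And>g x y. g \<in> automorphisms G \<Longrightarrow> g w = w \<Longrightarrow> x \<in> pverts G \<Longrightarrow> y \<in> pverts G \<Longrightarrow>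
      R (g x) (g y) \<longleftrightarrow> R x y"
  shows "(\<lambda>x y. of_bool (x \<in> pverts G \<and> y \<in> pverts G \<and> R x y)) \<in> stabilizer_centralizer G w"
    (is "?M \<in> _")
  unfolding stabilizer_centralizer_def
proof (intro CollectI conjI ballI impI ext)
  show "?M \<in> cmats (pverts G)"
    by (auto simp: cmats_def)
next
  fix g x y assume g: "g \<in> automorphisms G" "g w = w"
  then have perm: "g permutes pverts G"
    by (simp add: automorphisms_def)
  \<comment> \<open>Column \<open>y\<close> of the permutation matrix has at most one nonzero entry,
    in row \<open>y0\<close>; this collapses the first product to a single term.\<close>
  obtain y0 where y: "y = g y0"
    using perm by (metis permutes_surj surjD)
  have gV: "g u \<in> pverts G \<longleftrightarrow> u \<in> pverts G" for u
    using perm by (rule permutes_in_image)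
  have "mat_mult (pverts G) ?M (perm_mat (pverts G) g) x y =
      (\<Sum>z\<in>pverts G. if z = y0 then ?M x y0 else 0)"
    unfolding mat_mult_def perm_mat_def y
    by (intro sum.cong refl) (use permutes_inj[OF perm] in \<open>auto simp: inj_eq\<close>)
  also have "\<dots> = ?M x y0"
    using fin by (simp add: sum.delta)
  also have "\<dots> = of_bool (x \<in> pverts G) * ?M (g x) y"
    using inv[OF g] by (auto simp: y gV)
  also have "\<dots> = (\<Sum>z\<in>pverts G. if z = g x then of_bool (x \<in> pverts G) * ?M (g x) y else 0)"
    using fin by (simp add: sum.delta gV)
  also have "\<dots> = mat_mult (pverts G) (perm_mat (pverts G) g) ?M x y"
    unfolding mat_mult_def perm_mat_def by (intro sum.cong refl) auto
  finally show "mat_mult (pverts G) ?M (perm_mat (pverts G) g) x y =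
    mat_mult (pverts G) (perm_mat (pverts G) g) ?M x y" .
qed

definition dominates_common_neighbours :: "'a pair_pre_digraph \<Rightarrow> 'a \<Rightarrow> 'a \<Rightarrow> 'a \<Rightarrow> bool" where
  "dominates_common_neighbours G w x y \<longleftrightarrow>
     (\<forall>z\<in>pverts G. (w, z) \<in> parcs G \<and> (x, z) \<in> parcs G \<longrightarrow> z = y \<or> (z, y) \<in> parcs G)"

lemma dominates_common_neighbours_automorphism:
  assumes g: "g \<in> automorphisms G" and V: "w \<in> pverts G" "x \<in> pverts G" "y \<in> pverts G"
  shows "dominates_common_neighbours G (g w) (g x) (g y) \<longleftrightarrow> dominates_common_neighbours G w x y"
proof -
  have perm: "g permutes pverts G"
    and edge: "\<And>u v. u \<in> pverts G \<Longrightarrow> v \<in> pverts G \<Longrightarrow> (g u, g v) \<in> parcs G \<longleftrightarrow> (u, v) \<in> parcs G"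
    using g by (auto simp: automorphisms_def)
  have "dominates_common_neighbours G (g w) (g x) (g y) \<longleftrightarrow>
     (\<forall>z\<in>g ` pverts G. (g w, z) \<in> parcs G \<and> (g x, z) \<in> parcs G \<longrightarrow> z = g y \<or> (z, g y) \<in> parcs G)"
    by (simp add: dominates_common_neighbours_def permutes_image[OF perm])
  also have "\<dots> \<longleftrightarrow> dominates_common_neighbours G w x y"
    using V by (simp add: dominates_common_neighbours_def edge inj_eq[OF permutes_inj[OF perm]])
  finally show ?thesis .
qed

text \<open>The 0/1 matrix of the domination relation commutes with the vertex stabilizer. Triple
  transitivity would place it in the span of the triple products, whose members cannot separate
  \<open>y\<close> from \<open>y'\<close>.\<close>

lemma not_triply_transitive_if_distinguishable_triangles:
  assumes fin: "finite (pverts G)" and loopfree: "\<And>v. (v, v) \<notin> parcs G"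
    and V: "w \<in> pverts G" "x \<in> pverts G" "y \<in> pverts G" "y' \<in> pverts G"
    and E: "(w, y) \<in> parcs G" "(w, y') \<in> parcs G" "(x, y) \<in> parcs G" "(x, y') \<in> parcs G"
    and D: "dominates_common_neighbours G w x y" "\<not> dominates_common_neighbours G w x y'"
  shows "\<not> triply_transitive G"
proof
  assume "triply_transitive G"
  then obtain u where u: "u \<in> pverts G" and vt: "vertex_transitive G"
    and eq: "terwilliger_span G u = stabilizer_centralizer G u"
    unfolding triply_transitive_def by blast
  \<comment> \<open>The equality of algebras is given at some vertex \<open>u\<close> only, so both
    configurations are carried from \<open>w\<close> to \<open>u\<close> by an automorphism.\<close>
  obtain g where g: "g \<in> automorphisms G" and gw: "g w = u"
    using vt V(1) u unfolding vertex_transitive_def by blast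
  then have gV: "\<And>v. g v \<in> pverts G \<longleftrightarrow> v \<in> pverts G"
    and gE: "\<And>a b. a \<in> pverts G \<Longrightarrow> b \<in> pverts G \<Longrightarrow> (g a, g b) \<in> parcs G \<longleftrightarrow> (a, b) \<in> parcs G"
    by (auto simp: automorphisms_def permutes_in_image)
  define M :: "'a cmat" where
    "M = (\<lambda>x y. of_bool (x \<in> pverts G \<and> y \<in> pverts G \<and> dominates_common_neighbours G u x y))"
  have "M \<in> terwilliger_span G u"
    unfolding M_def eq
    by (rule invariant_in_stabilizer_centralizer[OF fin])
      (metis dominates_common_neighbours_automorphism u)
  then have "M (g x) (g y) = M (g x) (g y')"
    by (rule terwilliger_span_const_on_triangles)
      (use fin u V E gV gE loopfree in \<open>auto simp flip: gw\<close>)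
  moreover have "M (g x) (g y) = 1" "M (g x) (g y') = 0"
    using V D by (auto simp: M_def gV dominates_common_neighbours_automorphism[OF g] simp flip: gw)
  ultimately show False by simp
qed


section \<open>Linear functionals\<close>

context vector_space
begin

text \<open>Any \<open>u\<close> with \<open>f u \<noteq> 0\<close> spans a complement of the kernel
  of \<open>f\<close>, so the factor must be \<open>g u / f u\<close>.\<close>

lemma functional_multiple_if_kernel_subset:
  assumes f: "Vector_Spaces.linear scale (*) f" and g: "Vector_Spaces.linear scale (*) g"
    and ker: "\<And>v. f v = 0 \<Longrightarrow> g v = 0"
  shows "\<exists>a. \<forall>v. g v = a * f v"
proof (cases "\<forall>v. f v = 0")
  case True
  then show ?thesis using ker by simp
next
  case False
  then obtain u where u: "f u \<noteq> 0" by blast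
  interpret f: Vector_Spaces.linear scale "(*)" f by (rule f)
  interpret g: Vector_Spaces.linear scale "(*)" g by (rule g)
  have "g v = (g u / f u) * f v" for v
  proof -
    have "f (v - scale (f v / f u) u) = 0" using u by (simp add: f.diff f.scale)
    then have "g (v - scale (f v / f u) u) = 0" by (rule ker)
    then show ?thesis by (simp add: g.diff g.scale mult.commute)
  qed
  then show ?thesis by blast
qed

lemma functional_combination_if_kernels_subset:
  assumes f1: "Vector_Spaces.linear scale (*) f1" and f2: "Vector_Spaces.linear scale (*) f2"
    and g: "Vector_Spaces.linear scale (*) g"
    and ker: "\<And>v. f1 v = 0 \<Longrightarrow> f2 v = 0 \<Longrightarrow> g v = 0"
  shows "\<exists>a b. \<forall>v. g v = a * f1 v + b * f2 v"
proof (cases "\<forall>v. f1 v = 0 \<longrightarrow> f2 v = 0")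
  case True
  then obtain a where "\<forall>v. g v = a * f1 v"
    using functional_multiple_if_kernel_subset[OF f1 g] ker by blast
  then have "\<forall>v. g v = a * f1 v + 0 * f2 v" by simp
  then show ?thesis by blast
next
  case False
  then obtain u where u: "f1 u = 0" "f2 u \<noteq> 0" by blast
  \<comment> \<open>This choice makes \<open>g - b * f2\<close> vanish at \<open>u\<close>, and then
    on the whole kernel of \<open>f1\<close>, which reduces the claim to a single
    functional.\<close>
  define b where "b = g u / f2 u"
  have lin: "Vector_Spaces.linear scale (*) (\<lambda>v. g v - b * f2 v)"
    using f2 g unfolding Vector_Spaces.linear_iff by (simp add: algebra_simps)
  interpret f1: Vector_Spaces.linear scale "(*)" f1 by (rule f1)
  interpret f2: Vector_Spaces.linear scale "(*)" f2 by (rule f2)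
  interpret g: Vector_Spaces.linear scale "(*)" g by (rule g)
  have "g v - b * f2 v = 0" if "f1 v = 0" for v
  proof -
    have "g (v - scale (f2 v / f2 u) u) = 0"
      using u that by (intro ker) (simp_all add: f1.diff f1.scale f2.diff f2.scale)
    then show ?thesis by (simp add: g.diff g.scale b_def mult.commute)
  qed
  then obtain a where a: "\<forall>v. g v - b * f2 v = a * f1 v"
    using functional_multiple_if_kernel_subset[OF f1 lin] by blast
  then have "\<forall>v. g v = a * f1 v + b * f2 v"
    by (metis diff_add_cancel)
  then show ?thesis by blast
qed

lemma dim_1_obtain_generator:
  assumes "subspace P" "dim P = 1"
  obtains u where "u \<noteq> 0" "P = span {u}"
proof -
  obtain B where B: "B \<subseteq> P" "independent B" "P \<subseteq> span B" "card B = 1"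
    using basis_exists[of P] assms(2) by metis
  then obtain u where "B = {u}" by (metis card_1_singletonE)
  then show ?thesis
    using B assms(1) that[of u] by (metis dependent_single span_minimal subset_antisym)
qed

lemma span_pair_obtain:
  assumes "z \<in> span {u, v}"
  obtains a b where "z = scale a u + scale b v"
proof -
  obtain a where "z - scale a u \<in> span {v}"
    using assms unfolding span_breakdown_eq[of z u "{v}"] by blast
  then obtain b where "z - scale a u = scale b v"
    by (auto simp: span_singleton)
  then have "z = scale a u + scale b v"
    by (metis add_diff_cancel_left' add.commute diff_add_cancel)
  then show ?thesis by (rule that)
qed

lemma span_Un_span_singletons: "span (span {u} \<union> span {v}) = span {u, v}"
proof (rule subset_antisym)
  have "span {u} \<subseteq> span {u, v}" "span {v} \<subseteq> span {u, v}"
    by (auto intro!: span_mono)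
  then show "span (span {u} \<union> span {v}) \<subseteq> span {u, v}"
    by (intro span_minimal) auto
  show "span {u, v} \<subseteq> span (span {u} \<union> span {v})"
    by (intro span_mono) (auto simp: span_base)
qed

end


section \<open>Polar spaces\<close>

fun form_map :: "('k::field, 'v::ab_group_add) form \<Rightarrow> 'v \<Rightarrow> 'v \<Rightarrow> 'k" where
  "form_map (Alternating B) = B"
| "form_map (Hermitian \<sigma> H) = H"
| "form_map (Quadratic Q) = polar_form Q"

text \<open>Kept apart from \<open>form_map \<phi> x x = 0\<close>: in characteristic 2 the polar
  form of a quadratic form vanishes on every pair \<open>(x, x)\<close>, singular or not.\<close>

fun isotropic_vector :: "('k::field, 'v::ab_group_add) form \<Rightarrow> 'v \<Rightarrow> bool" where
  "isotropic_vector (Alternating B) x \<longleftrightarrow> B x x = 0"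
| "isotropic_vector (Hermitian \<sigma> H) x \<longleftrightarrow> H x x = 0"
| "isotropic_vector (Quadratic Q) x \<longleftrightarrow> Q x = 0"

text \<open>The field automorphism by which scalars leave the second argument of
  \<open>form_map\<close>.\<close>

fun companion_automorphism :: "('k::field, 'v::ab_group_add) form \<Rightarrow> 'k \<Rightarrow> 'k" where
  "companion_automorphism (Alternating B) = id"
| "companion_automorphism (Hermitian \<sigma> H) = \<sigma>"
| "companion_automorphism (Quadratic Q) = id"

text \<open>The trace map \<open>d + \<sigma> d\<close> is linear over the fixed field of
  \<open>\<sigma>\<close>. Once it takes a nonzero value \<open>t\<close>, scaling the preimage by
  the fixed element \<open>h / t\<close> reaches \<open>h\<close>.\<close>

lemma field_involution_trace_surj:
  fixes \<sigma> :: "'k::field \<Rightarrow> 'k"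
  assumes \<sigma>: "field_involution \<sigma>" and h: "\<sigma> h = h"
  obtains c where "c + \<sigma> c = h"
proof -
  have add: "\<And>a b. \<sigma> (a + b) = \<sigma> a + \<sigma> b" and mult: "\<And>a b. \<sigma> (a * b) = \<sigma> a * \<sigma> b"
    and invol: "\<And>a. \<sigma> (\<sigma> a) = a" and ne: "\<sigma> \<noteq> id"
    using \<sigma> by (auto simp: field_involution_def)
  have "\<sigma> (\<sigma> 1 * 1) = \<sigma> (\<sigma> 1) * \<sigma> 1" by (rule mult)
  then have one: "\<sigma> 1 = 1" by (simp add: invol)
  have "\<exists>d. d + \<sigma> d \<noteq> 0"
  proof (rule ccontr)
    assume "\<not> ?thesis"
    then have z: "\<And>d. d + \<sigma> d = 0" by blast
    \<comment> \<open>A zero trace at 1 forces characteristic 2, and then a zero trace everywhere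
      makes \<open>\<sigma>\<close> the identity.\<close>
    have "(1::'k) + 1 = 0" using z[of 1] one by simp
    then have "\<And>d::'k. d + d = 0" by (metis distrib_left mult.right_neutral mult_zero_right)
    then have "\<And>d. \<sigma> d = d" using z by (metis add_left_cancel)
    then show False using ne by auto
  qed
  then obtain d where d: "d + \<sigma> d \<noteq> 0" by blast
  define t where "t = d + \<sigma> d"
  have t: "\<sigma> t = t" "t \<noteq> 0" using d by (simp_all add: t_def add invol add.commute)
  have "\<sigma> (h / t) * t = h"
    using mult[of "h / t" t] t h by simp
  then have ht: "\<sigma> (h / t) = h / t"
    using t by (simp add: field_simps)
  have "d * (h / t) + \<sigma> (d * (h / t)) = (d + \<sigma> d) * (h / t)"
    by (simp only: mult ht distrib_right)
  also have "\<dots> = h"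
    using t by (simp flip: t_def)
  finally show ?thesis by (rule that)
qed

context classical_polar_space
begin

abbreviation "F \<equiv> form_map \<phi>"
abbreviation "S \<equiv> isotropic_vector \<phi>"
abbreviation "\<tau> \<equiv> companion_automorphism \<phi>"

section \<open>A uniform calculus for the three kinds of form\<close>

lemma
  assumes "\<phi> = Hermitian \<sigma> H"
  shows hermitian_form_swap: "H y x = \<sigma> (H x y)"
    and hermitian_form_involution: "field_involution \<sigma>"
    and hermitian_form_linear_left: "Vector_Spaces.linear scale (*) (\<lambda>x. H x y)"
  using nondegenerate unfolding assms nondegenerate_form.simps hermitian_form_def by blast+

lemma form_linear_left: "Vector_Spaces.linear scale (*) (\<lambda>x. F x y)"
proof (cases \<phi>)
  case (Hermitian \<sigma> H)
  then show ?thesis by (simp add: hermitian_form_linear_left)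
qed (use nondegenerate in \<open>auto simp: alternating_form_def bilinear_form_def quadratic_form_def\<close>)

lemma form_add_left: "F (x + y) z = F x z + F y z"
  and form_scale_left: "F (scale c x) z = c * F x z"
proof -
  interpret Vector_Spaces.linear scale "(*)" "\<lambda>x. F x z" by (rule form_linear_left)
  show "F (x + y) z = F x z + F y z" "F (scale c x) z = c * F x z"
    by (simp_all add: add scale)
qed

lemma alternating_form_swap:
  assumes "\<phi> = Alternating B"
  shows "B x y = - B y x"
proof -
  have "\<And>z. B z z = 0" and r: "\<And>x y z. B x (y + z) = B x y + B x z"
    and l: "\<And>x y z. B (x + y) z = B x z + B y z"
    using nondegenerate assms
    by (auto simp: alternating_form_def bilinear_form_def Vector_Spaces.linear_iff)
  moreover have "B (x + y) (x + y) = B x x + B x y + (B y x + B y y)"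
    by (simp add: l r)
  ultimately show ?thesis by (simp add: eq_neg_iff_add_eq_0)
qed

text \<open>Swapping the arguments changes the value by a sign, by \<open>\<sigma>\<close>, or not
  at all, and each of these fixes 0.\<close>

lemma form_swap_eq_0: "F x y = 0 \<Longrightarrow> F y x = 0"
proof (cases \<phi>)
  case (Alternating B)
  then show "F x y = 0 \<Longrightarrow> F y x = 0"
    using alternating_form_swap[OF Alternating, of x y] by simp
next
  case (Hermitian \<sigma> H)
  have "\<sigma> (0 + 0) = \<sigma> 0 + \<sigma> 0"
    using hermitian_form_involution[OF Hermitian] unfolding field_involution_def by blast
  then have "\<sigma> 0 = 0" by (simp only: add_0_right add_cancel_right_right)
  then show "F x y = 0 \<Longrightarrow> F y x = 0"
    using hermitian_form_swap[OF Hermitian, of y x] Hermitian by simp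
next
  case (Quadratic Q)
  then show "F x y = 0 \<Longrightarrow> F y x = 0"
    by (simp add: polar_form_def add.commute diff_diff_eq)
qed

lemma form_add_right: "F x (y + z) = F x y + F x z"
  and form_scale_right: "F x (scale c y) = \<tau> c * F x y"
proof -
  have "F x (y + z) = F x y + F x z \<and> F x (scale c y) = \<tau> c * F x y"
  proof (cases \<phi>)
    case (Alternating B)
    then show ?thesis
      using nondegenerate by (auto simp: alternating_form_def bilinear_form_def Vector_Spaces.linear_iff)
  next
    case (Quadratic Q)
    then show ?thesis
      using nondegenerate by (auto simp: quadratic_form_def bilinear_form_def Vector_Spaces.linear_iff)
  next
    case (Hermitian \<sigma> H)
    note sw = hermitian_form_swap[OF Hermitian, of x]
    have "\<And>a b. \<sigma> (a + b) = \<sigma> a + \<sigma> b" "\<And>a b. \<sigma> (a * b) = \<sigma> a * \<sigma> b"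
      using hermitian_form_involution[OF Hermitian] unfolding field_involution_def by blast+
    then show ?thesis
      using form_add_left[of y z x] form_scale_left[of c y x] Hermitian
        sw[of y] sw[of z] sw[of "y + z"] sw[of "scale c y"]
      by simp
  qed
  then show "F x (y + z) = F x y + F x z" "F x (scale c y) = \<tau> c * F x y" by auto
qed

lemma companion_automorphism_involutive: "\<tau> (\<tau> c) = c"
proof (cases \<phi>)
  case (Hermitian \<sigma> H)
  then show ?thesis
    using hermitian_form_involution[OF Hermitian] by (simp add: field_involution_def)
qed simp_all

lemma form_zero_left [simp]: "F 0 y = 0"
  using form_scale_left[of 0 0 y] by simp

lemma form_zero_right [simp]: "F y 0 = 0"
  by (rule form_swap_eq_0) simp

lemma isotropic_vector_form_self: "S x \<Longrightarrow> F x x = 0"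
proof (cases \<phi>)
  case (Quadratic Q)
  assume "S x"
  have "\<And>c x. Q (scale c x) = c\<^sup>2 * Q x"
    using nondegenerate Quadratic by (simp add: quadratic_form_def)
  from this[of "1 + 1" x] have "Q (x + x) = (1 + 1)\<^sup>2 * Q x"
    by (simp only: scale_left_distrib scale_one)
  then show ?thesis
    using \<open>S x\<close> Quadratic by (simp add: polar_form_def)
qed auto

lemma isotropic_vector_scale: "S x \<Longrightarrow> S (scale c x)"
proof (cases \<phi>)
  case (Quadratic Q)
  then show "S x \<Longrightarrow> S (scale c x)"
    using nondegenerate by (simp add: quadratic_form_def)
qed (use form_scale_left form_scale_right in auto)

lemma isotropic_vector_add: "S x \<Longrightarrow> S y \<Longrightarrow> F x y = 0 \<Longrightarrow> S (x + y)"
proof (cases \<phi>)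
  case (Quadratic Q)
  then show "S x \<Longrightarrow> S y \<Longrightarrow> F x y = 0 \<Longrightarrow> S (x + y)"
    by (simp add: polar_form_def)
qed (use form_add_left form_add_right form_swap_eq_0 in auto)

text \<open>Non-degeneracy in the shape common to all three cases; for a quadratic form it speaks
  only of singular vectors of the radical, whence \<open>S x\<close>.\<close>

lemma isotropic_vector_in_radical:
  assumes "S x" "\<And>y. F x y = 0"
  shows "x = 0"
proof -
  have "S x \<and> (\<forall>y. F x y = 0) \<longrightarrow> x = 0"
    using nondegenerate
    by (cases \<phi>) (simp only: nondegenerate_form.simps form_map.simps isotropic_vector.simps, blast)+
  then show ?thesis using assms by blast
qed

lemma totally_isotropic_iff:
  "totally_isotropic scale \<phi> U \<longleftrightarrow> subspace U \<and> (\<forall>x\<in>U. S x) \<and> (\<forall>x\<in>U. \<forall>y\<in>U. F x y = 0)"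
proof (cases \<phi>)
  case (Quadratic Q)
  then show ?thesis by (auto simp: polar_form_def subspace_add)
qed auto

text \<open>Since \<open>y\<close> is isotropic, the term of second order in \<open>c\<close> drops
  out. What remains is a trace equation in the Hermitian case and a linear equation in the quadratic
  case; \<open>F v y \<noteq> 0\<close> makes both solvable.\<close>

lemma isotropic_shift:
  assumes "S y" "F v y \<noteq> 0"
  obtains c where "S (v + scale c y)"
proof (cases \<phi>)
  case (Alternating B)
  then show ?thesis
    using that nondegenerate by (simp add: alternating_form_def)
next
  case (Hermitian \<sigma> H)
  note sw = hermitian_form_swap[OF Hermitian] and \<sigma> = hermitian_form_involution[OF Hermitian]
  have \<sigma>_add: "\<And>a b. \<sigma> (a + b) = \<sigma> a + \<sigma> b" and \<sigma>_mult: "\<And>a b. \<sigma> (a * b) = \<sigma> a * \<sigma> b"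
    using \<sigma> unfolding field_involution_def by blast+
  have "\<sigma> (H v v) = H v v" using sw[of v v] by simp
  from field_involution_trace_surj[OF \<sigma> this]
  obtain e' where e': "e' + \<sigma> e' = H v v" .
  define e where "e = - e'"
  have "\<sigma> 0 = 0" using \<sigma>_add[of 0 0] by (simp only: add_0_right add_cancel_right_right)
  then have "\<sigma> e = - \<sigma> e'" using \<sigma>_add[of e e'] by (simp add: e_def eq_neg_iff_add_eq_0)
  then have e: "e + \<sigma> e = - H v v" using e' by (simp add: e_def flip: e')
  have ne: "H y v \<noteq> 0"
    using assms(2) form_swap_eq_0[of y v] Hermitian by auto
  \<comment> \<open>With this \<open>c\<close> the two cross terms are \<open>e\<close> and
    \<open>\<sigma> e\<close>, whose sum cancels \<open>H v v\<close>.\<close>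
  define c where "c = e / H y v"
  have "\<sigma> c * H v y = \<sigma> (c * H y v)"
    using sw[of v y] by (simp add: \<sigma>_mult)
  moreover have "c * H y v = e" using ne by (simp add: c_def)
  moreover have "H (v + scale c y) (v + scale c y) =
      H v v + c * H y v + (\<sigma> c * H v y + c * (\<sigma> c * H y y))"
    using form_add_left form_scale_left form_add_right form_scale_right Hermitian
    by (simp add: algebra_simps)
  ultimately have "H (v + scale c y) (v + scale c y) = H v v + (e + \<sigma> e)"
    using assms(1) Hermitian \<sigma>_mult[of c "H y v"] sw[of v y] by (simp add: add.assoc)
  then have "H (v + scale c y) (v + scale c y) = 0"
    by (simp add: e)
  then show ?thesis using that Hermitian by simp
next
  case (Quadratic Q)
  define c where "c = - Q v / polar_form Q v y"
  have "polar_form Q v (scale c y) = c * polar_form Q v y"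
    using form_scale_right[of v c y] Quadratic by simp
  then have "Q (v + scale c y) = Q v + Q (scale c y) + c * polar_form Q v y"
    by (simp add: polar_form_def algebra_simps)
  also have "Q (scale c y) = 0"
    using isotropic_vector_scale[of y c] assms(1) Quadratic by simp
  finally show ?thesis
    using that[of c] assms(2) Quadratic by (simp add: c_def)
qed

section \<open>Points and adjacency through generating vectors\<close>

lemma polar_points_eq: "polar_points scale \<phi> = {span {u} | u. S u \<and> u \<noteq> 0}"
proof (intro set_eqI iffI)
  fix P assume "P \<in> polar_points scale \<phi>"
  then have P: "totally_isotropic scale \<phi> P" "dim P = 1" "subspace P"
    by (auto simp: polar_points_def totally_isotropic_iff)
  obtain u where "u \<noteq> 0" "P = span {u}"
    using dim_1_obtain_generator P by metis
  moreover from this P have "S u"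
    by (auto simp: totally_isotropic_iff span_base)
  ultimately show "P \<in> {span {u} | u. S u \<and> u \<noteq> 0}" by blast
next
  fix P assume "P \<in> {span {u} | u. S u \<and> u \<noteq> 0}"
  then obtain u where u: "S u" "u \<noteq> 0" "P = span {u}" by blast
  have "dim P = 1"
    using dim_eq_card_independent[of "{u}"] u by simp
  moreover have "subspace P"
    using u subspace_span by blast
  then have "totally_isotropic scale \<phi> P"
    using u isotropic_vector_form_self[OF u(1)]
    by (auto simp: totally_isotropic_iff span_singleton isotropic_vector_scale
        form_scale_left form_scale_right)
  ultimately show "P \<in> polar_points scale \<phi>" by (simp add: polar_points_def)
qed

lemma totally_isotropic_span_pair_iff:
  assumes "S u" "S v"
  shows "totally_isotropic scale \<phi> (span {u, v}) \<longleftrightarrow> F u v = 0"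
proof
  assume "totally_isotropic scale \<phi> (span {u, v})"
  then show "F u v = 0" by (simp add: totally_isotropic_iff span_base)
next
  assume 0: "F u v = 0"
  have z: "F u u = 0" "F v v = 0" "F v u = 0"
    using assms isotropic_vector_form_self form_swap_eq_0[OF 0] by auto
  have "S x" if x: "x \<in> span {u, v}" for x
  proof -
    obtain a b where "x = scale a u + scale b v" using x by (rule span_pair_obtain)
    then show ?thesis
      using assms 0
      by (simp add: isotropic_vector_add isotropic_vector_scale form_scale_left form_scale_right)
  qed
  moreover have "F x y = 0" if x: "x \<in> span {u, v}" and y: "y \<in> span {u, v}" for x y
  proof -
    obtain a b where "x = scale a u + scale b v" using x by (rule span_pair_obtain)
    moreover obtain c d where "y = scale c u + scale d v" using y by (rule span_pair_obtain)
    ultimately show ?thesis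
      using z 0 by (simp add: form_add_left form_add_right form_scale_left form_scale_right)
  qed
  ultimately show "totally_isotropic scale \<phi> (span {u, v})"
    by (simp add: totally_isotropic_iff)
qed

lemma adjacent_span_iff:
  assumes "S u" "u \<noteq> 0" "S v" "v \<noteq> 0"
  shows "(span {u}, span {v}) \<in> parcs (collinearity_graph scale \<phi>) \<longleftrightarrow>
    span {u} \<noteq> span {v} \<and> F u v = 0"
  using assms totally_isotropic_span_pair_iff[OF assms(1,3)]
  by (auto simp: collinearity_graph_def polar_points_eq span_Un_span_singletons)

text \<open>Over a finite field, adding one generator replaces a span by a finite union of its
  translates.\<close>

lemma finite_span:
  assumes "finite B"
  shows "finite (span B)"
  using assms
proof (induction B)
  case (insert b B)
  have "span (insert b B) \<subseteq> (\<Union>k. (\<lambda>x. scale k b + x) ` span B)"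
  proof
    fix x assume "x \<in> span (insert b B)"
    then obtain k where "x - scale k b \<in> span B" by (auto simp: span_breakdown_eq)
    then have "x \<in> (\<lambda>x. scale k b + x) ` span B"
      by (intro image_eqI[of _ _ "x - scale k b"]) auto
    then show "x \<in> (\<Union>k. (\<lambda>x. scale k b + x) ` span B)" by blast
  qed
  moreover have "finite (\<Union>k. (\<lambda>x. scale k b + x) ` span B)"
    using insert.IH by simp
  ultimately show ?case by (rule finite_subset)
qed simp

lemma finite_polar_points: "finite (polar_points scale \<phi>)"
proof -
  have "finite (UNIV :: 'v set)"
    using finite_span[OF finite_Basis] by (simp add: span_Basis)
  then have "finite (Pow UNIV :: 'v set set)"
    by (simp only: finite_Pow_iff)
  then show ?thesis by (rule finite_subset[rotated]) simp
qed

section \<open>Two kinds of triangles in rank at least 3\<close>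

lemma obtain_totally_isotropic_triple:
  assumes "3 \<le> polar_rank scale \<phi>"
  obtains u v w where "independent {u, v, w}" "card {u, v, w} = 3"
    "S u" "S v" "S w" "F u v = 0" "F u w = 0" "F v w = 0"
proof -
  \<comment> \<open>The rank is a \<open>Max\<close>, known to be attained only on a finite nonempty
    set: dimensions are bounded by that of the whole space, and the zero subspace is totally
    isotropic.\<close>
  let ?D = "{dim U | U. totally_isotropic scale \<phi> U}"
  have "?D \<subseteq> {..dimension}"
    using dim_subset_UNIV by auto
  then have fin: "finite ?D" by (rule finite_subset) simp
  have "S 0"
  proof (cases \<phi>)
    case (Quadratic Q)
    then have "\<And>c x. Q (scale c x) = c\<^sup>2 * Q x"
      using nondegenerate by (simp add: quadratic_form_def)
    from this[of 0 0] show ?thesis using Quadratic by simp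
  qed (use form_zero_left[of 0] in simp_all)
  then have "totally_isotropic scale \<phi> {0}"
    by (simp add: totally_isotropic_iff)
  then have "?D \<noteq> {}" by blast
  from Max_in[OF fin this] obtain U where U: "totally_isotropic scale \<phi> U" "3 \<le> dim U"
    using assms unfolding polar_rank_def by auto
  obtain B where B: "B \<subseteq> U" "independent B" "card B = dim U"
    using basis_exists by metis
  obtain T where T: "T \<subseteq> B" "card T = 3"
    using obtain_subset_with_card_n[of 3 B] B(3) U(2) by metis
  obtain u v w where "T = {u, v, w}"
    using T(2) by (auto simp: card_3_iff)
  have "T \<subseteq> U" "independent T"
    using T B independent_mono by blast+
  with T U that[of u v w] show ?thesis
    by (auto simp: \<open>T = {u, v, w}\<close> totally_isotropic_iff)
qed

text \<open>If every vector orthogonal to \<open>u\<close> and \<open>v\<close> were orthogonal to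
  \<open>w\<close>, a combination of the three with coefficient 1 at \<open>w\<close> would be an
  isotropic vector of the radical, hence zero, against independence. A separating vector is then
  made isotropic by a shift along \<open>w\<close>.\<close>

lemma obtain_isotropic_separating:
  assumes ind: "independent {u, v, w}" "card {u, v, w} = 3"
    and S: "S u" "S v" "S w" and F: "F u v = 0" "F u w = 0" "F v w = 0"
  obtains z where "S z" "F z u = 0" "F z v = 0" "F z w \<noteq> 0"
proof -
  have "\<exists>z. F z u = 0 \<and> F z v = 0 \<and> F z w \<noteq> 0"
  proof (rule ccontr)
    assume "\<not> ?thesis"
    then obtain a b where ab: "\<And>z. F z w = a * F z u + b * F z v"
      using functional_combination_if_kernels_subset[OF form_linear_left form_linear_left form_linear_left]
      by metis
    \<comment> \<open>The form is \<open>\<tau>\<close>-semilinear on the right and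
      \<open>\<tau>\<close> is an involution or the identity, so these scalars come out of the form
      as \<open>- a\<close> and \<open>- b\<close>.\<close>
    define a' b' where "a' = \<tau> (- a)" and "b' = \<tau> (- b)"
    define x where "x = w + (scale a' u + scale b' v)"
    have "F z x = 0" for z
      by (simp add: x_def a'_def b'_def form_add_right form_scale_right
          companion_automorphism_involutive ab)
    then have "F x z = 0" for z using form_swap_eq_0 by blast
    moreover have "S x"
      unfolding x_def using S F form_swap_eq_0[OF F(2)] form_swap_eq_0[OF F(3)]
      by (intro isotropic_vector_add isotropic_vector_scale)
        (simp_all add: form_add_right form_scale_left form_scale_right)
    ultimately have "x = 0" using isotropic_vector_in_radical by blast
    then have "w = - (scale a' u + scale b' v)"
      by (simp only: x_def eq_neg_iff_add_eq_0)
    then have "w \<in> span {u, v}"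
      by (simp only: span_neg span_add span_scale span_base insert_iff simp_thms)
    moreover have "w \<notin> {u, v}" using ind(2) by (auto simp: card_insert_if split: if_splits)
    moreover have "independent (insert w {u, v})"
      using ind(1) by (simp add: insert_commute)
    ultimately show False
      by (simp add: independent_insert)
  qed
  then obtain z where z: "F z u = 0" "F z v = 0" "F z w \<noteq> 0" by blast
  obtain c where "S (z + scale c w)"
    using isotropic_shift[OF S(3) z(3)] .
  \<comment> \<open>The shift keeps all three conditions, since \<open>w\<close> is orthogonal to
    \<open>u\<close>, to \<open>v\<close> and to itself.\<close>
  then show ?thesis
    using that[of "z + scale c w"] z form_swap_eq_0[OF F(2)] form_swap_eq_0[OF F(3)]
      isotropic_vector_form_self[OF S(3)]
    by (simp add: form_add_left form_scale_left)
qed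

text \<open>The edge from \<open>span {u}\<close> to \<open>span {v}\<close> is completed to a
  triangle by \<open>span {u + v}\<close>, a third point of their line over any field, and by
  \<open>span {w}\<close>, a point off that line.\<close>

lemma not_triply_transitive_collinearity_graph:
  assumes "3 \<le> polar_rank scale \<phi>"
  shows "\<not> triply_transitive (collinearity_graph scale \<phi>)"
proof -
  let ?G = "collinearity_graph scale \<phi>"
  obtain u v w where ind: "independent {u, v, w}" "card {u, v, w} = 3"
    and S: "S u" "S v" "S w" and F: "F u v = 0" "F u w = 0" "F v w = 0"
    using obtain_totally_isotropic_triple[OF assms] .
  obtain z where z: "S z" "F z u = 0" "F z v = 0" "F z w \<noteq> 0"
    using obtain_isotropic_separating[OF ind S F] .
  have dist: "u \<noteq> v" "u \<noteq> w" "v \<noteq> w"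
    using ind(2) by (auto simp: card_insert_if split: if_splits)
  have n: "u \<noteq> 0" "v \<noteq> 0" "w \<noteq> 0" "z \<noteq> 0"
    using ind(1) dependent_zero z by auto
  have nv: "u \<notin> span {v}" "v \<notin> span {u}" "w \<notin> span {u}" "w \<notin> span {v}"
  proof -
    have "x \<notin> span {y}" if "{x, y} \<subseteq> {u, v, w}" "x \<noteq> y" for x y
      using independent_mono[OF ind(1) that(1)] that(2) independent_insert[of x "{y}"] by simp
    then show "u \<notin> span {v}" "v \<notin> span {u}" "w \<notin> span {u}" "w \<notin> span {v}"
      using dist by auto
  qed
  have uv: "S (u + v)" using isotropic_vector_add S F by blast
  have "u + v \<notin> span {u}" "u + v \<notin> span {v}"
    using nv(1,2) span_diff[of "u + v" "{u}" u] span_diff[of "u + v" "{v}" v] span_base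
    by auto
  moreover have mem: "x \<in> span {x}" for x
    by (simp add: span_base)
  ultimately have ne: "span {u} \<noteq> span {u + v}" "span {v} \<noteq> span {u + v}"
      "span {u} \<noteq> span {w}" "span {v} \<noteq> span {w}" and n2: "u + v \<noteq> 0"
    using nv(3,4) span_zero[of "{u}"] by metis+
  have V: "span {x} \<in> pverts ?G" if "S x" "x \<noteq> 0" for x
    using that by (auto simp: collinearity_graph_def polar_points_eq)
  have Fvu: "F v u = 0" using form_swap_eq_0 F by blast
  note self = isotropic_vector_form_self
  \<comment> \<open>As \<open>z\<close> is not orthogonal to \<open>w\<close>, its point differs
    from every point orthogonal to \<open>w\<close>, in particular from those of \<open>u\<close>,
    \<open>v\<close> and \<open>w\<close> itself.\<close>
  have perp_sep: "span {z} \<noteq> span {x}" if "F x w = 0" "x \<noteq> 0" for x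
  proof
    assume "span {z} = span {x}"
    then have "z \<in> span {x}" using mem by blast
    then obtain k where "z = scale k x" by (auto simp: span_singleton)
    then show False using z(4) that by (simp add: form_scale_left)
  qed
  have dom: "dominates_common_neighbours ?G (span {u}) (span {v}) (span {u + v})"
    unfolding dominates_common_neighbours_def
  proof (intro ballI impI)
    fix P assume "P \<in> pverts ?G"
      and P: "(span {u}, P) \<in> parcs ?G \<and> (span {v}, P) \<in> parcs ?G"
    then obtain p where p: "P = span {p}" "S p" "p \<noteq> 0"
      by (auto simp: collinearity_graph_def polar_points_eq)
    then have "F u p = 0" "F v p = 0"
      using P adjacent_span_iff[of u p] adjacent_span_iff[of v p] S n by auto
    \<comment> \<open>What is orthogonal to two points of a line is orthogonal to the whole
      line.\<close>
    then have "F (u + v) p = 0" by (simp add: form_add_left)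
    then have "F p (u + v) = 0" by (rule form_swap_eq_0)
    then show "P = span {u + v} \<or> (P, span {u + v}) \<in> parcs ?G"
      using adjacent_span_iff[of p "u + v"] p uv n2 by blast
  qed
  have not_dom: "\<not> dominates_common_neighbours ?G (span {u}) (span {v}) (span {w})"
  proof
    assume "dominates_common_neighbours ?G (span {u}) (span {v}) (span {w})"
    \<comment> \<open>The point of \<open>z\<close> is the common neighbour that violates domination
      by \<open>span {w}\<close>.\<close>
    moreover have "(span {u}, span {z}) \<in> parcs ?G" "(span {v}, span {z}) \<in> parcs ?G"
      using adjacent_span_iff[of u z] adjacent_span_iff[of v z] S n z F
        form_swap_eq_0[OF z(2)] form_swap_eq_0[OF z(3)] perp_sep[of u] perp_sep[of v] by auto
    moreover have "span {z} \<noteq> span {w}" "(span {z}, span {w}) \<notin> parcs ?G"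
      using perp_sep[OF self[OF S(3)] n(3)] z adjacent_span_iff[of z w] S n by auto
    ultimately show False
      using V[OF z(1) n(4)] unfolding dominates_common_neighbours_def by blast
  qed
  show ?thesis
  proof (rule not_triply_transitive_if_distinguishable_triangles[OF _ _ _ _ _ _ _ _ _ _ dom not_dom])
    show "finite (pverts ?G)" by (simp add: collinearity_graph_def finite_polar_points)
    show "(x, x) \<notin> parcs ?G" for x by (simp add: collinearity_graph_def)
  qed (use V S n n2 uv adjacent_span_iff ne F Fvu self[OF S(1)] self[OF S(2)] in \<open>auto simp: form_add_right\<close>)
qed

end

theorem theorem6p7:
  fixes scale :: "'k::{field,finite} \<Rightarrow> 'v::ab_group_add \<Rightarrow> 'v"
    and Basis :: "'v set"
    and \<phi> :: "('k, 'v) form"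
  assumes "classical_polar_space scale Basis \<phi>"
    and "3 \<le> polar_rank scale \<phi>"
  shows "\<not> triply_transitive (collinearity_graph scale \<phi>)"
  using classical_polar_space.not_triply_transitive_collinearity_graph[OF assms] .

end
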